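(* Let $\alpha=\alpha(t)$, $t\in I_1$, and $\omega=\omega(s)$, $s\in I_2$, be regular planar curves with values in $\mathbb{C}\setminus\{0\}$ ($I_1,I_2$ intervals of $\mathbb{R}$), and let $\Phi=\alpha\ast\omega$ be the associated Lagrangian immersion. Then $\Phi$ has parallel (non null) mean curvature vector if and only if $\alpha$ and $\omega$ are both circles centered at the origin (that is, the trace of each is contained in a circle centered at the origin). Moreover, putting $\alpha(t)=e^{it}$ and $\omega(s)=R\,e^{is}$, $R>0$, the immersion $\Phi=\alpha\ast\omega$ can be written (taking base points $t_0=s_0=0$) as $$\Phi(t,s)=\left(i(R^2s-t),\ R\,e^{i(s+t)}\right),\quad (t,s)\in\mathbb{R}^2,$$ and its image is the right circular cylinder $i\mathbb{R}\times\mathbb{S}^1(R)\subset\mathbb{C}\times\mathbb{C}$, where $\mathbb{S}^1(R)$ is the circle of radius $R$ centered at the origin.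
   Context: For base points $t_0\in I_1,s_0\in I_2$, $$(\alpha\ast\omega)(t,s)=\left(\int_{s_0}^s\dot\omega(y)\overline{\omega(y)}\,dy-\int_{t_0}^t\alpha'(x)\overline{\alpha(x)}\,dx\, ,\ \alpha(t)\omega(s)\right)\in\mathbb{C}^2,$$ where $'$ and $\dot{}$ denote derivatives in $t$ and $s$; changing base points only changes the map by a translation. It is a Lagrangian immersion (the Kaehler form $-\mathrm{Im}(z_1\bar w_1+z_2\bar w_2)$ pulls back to zero) with induced metric $(|\alpha|^2+|\omega|^2)(|\alpha'|^2dt^2+|\dot\omega|^2ds^2)$. The mean curvature vector is $H=\mathrm{trace}\,\sigma$, with $\sigma$ the second fundamental form. It is parallel if $\nabla^\perp H=0$, where $\nabla^\perp$ is the normal connection; non null means $H$ is not identically zero. *)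

theory Defs
  imports "HOL-Analysis.Analysis"
begin

section \<open>Planar curves\<close>

text \<open>Intervals may be open, closed or half-open, bounded or not; all derivatives are taken
  within the interval, so they are one-sided at endpoints that belong to it.\<close>

definition nondeg_interval :: "real set \<Rightarrow> bool" where
  "nondeg_interval I \<longleftrightarrow> is_interval I \<and> interior I \<noteq> {}"

text \<open>\<open>D n\<close> is the \<open>n\<close>-th derivative of the curve.\<close>

definition smooth_curve_on :: "real set \<Rightarrow> (real \<Rightarrow> 'a::real_normed_vector) \<Rightarrow> bool" where
  "smooth_curve_on I c \<longleftrightarrow>
     (\<exists>D. D 0 = c \<and>
          (\<forall>n::nat. \<forall>t\<in>I. (D n has_vector_derivative D (Suc n) t) (at t within I)))"

definition regular_curve_on :: "real set \<Rightarrow> (real \<Rightarrow> 'a::real_normed_vector) \<Rightarrow> bool" where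
  "regular_curve_on I c \<longleftrightarrow>
     smooth_curve_on I c \<and> (\<forall>t\<in>I. vector_derivative c (at t within I) \<noteq> 0)"

definition centered_circle_on :: "real set \<Rightarrow> (real \<Rightarrow> complex) \<Rightarrow> bool" where
  "centered_circle_on I c \<longleftrightarrow> (\<exists>r>0. c ` I \<subseteq> sphere 0 r)"

section \<open>The immersion associated with a pair of curves\<close>

text \<open>\<open>LBINT y=a..b. f y\<close> is the oriented integral, so \<open>t < t0\<close> and \<open>s < s0\<close> are covered.\<close>

definition curve_star ::
  "real set \<Rightarrow> real set \<Rightarrow> real \<Rightarrow> real \<Rightarrow> (real \<Rightarrow> complex) \<Rightarrow> (real \<Rightarrow> complex)
     \<Rightarrow> real \<Rightarrow> real \<Rightarrow> complex \<times> complex" where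
  "curve_star I J t0 s0 \<alpha> \<omega> t s =
     ((LBINT y=s0..s. vector_derivative \<omega> (at y within J) * cnj (\<omega> y))
        - (LBINT x=t0..t. vector_derivative \<alpha> (at x within I) * cnj (\<alpha> x)),
      \<alpha> t * \<omega> s)"

section \<open>Extrinsic geometry of a parametrized surface\<close>

text \<open>A surface is a map \<open>F t s\<close> on \<open>I \<times> J\<close> with values in a Euclidean space; tangent vectors of
  the parameter domain are pairs of reals, their components in the coordinate frame.
  On \<^typ>\<open>complex \<times> complex\<close> the library's inner product is the real part of the Hermitian product
  \<open>z1 * cnj w1 + z2 * cnj w2\<close>, i.e. the Euclidean metric.\<close>

definition partial_t :: "real set \<Rightarrow> (real \<Rightarrow> real \<Rightarrow> 'a::real_normed_vector) \<Rightarrow> real \<Rightarrow> real \<Rightarrow> 'a"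
  where "partial_t I F t s = vector_derivative (\<lambda>x. F x s) (at t within I)"

definition partial_s :: "real set \<Rightarrow> (real \<Rightarrow> real \<Rightarrow> 'a::real_normed_vector) \<Rightarrow> real \<Rightarrow> real \<Rightarrow> 'a"
  where "partial_s J F t s = vector_derivative (\<lambda>y. F t y) (at s within J)"

definition dir_deriv ::
  "real set \<Rightarrow> real set \<Rightarrow> (real \<Rightarrow> real \<Rightarrow> 'a::real_normed_vector) \<Rightarrow> real \<Rightarrow> real \<Rightarrow> real \<times> real \<Rightarrow> 'a"
  where "dir_deriv I J F t s u = fst u *\<^sub>R partial_t I F t s + snd u *\<^sub>R partial_s J F t s"

definition tangent_plane ::
  "real set \<Rightarrow> real set \<Rightarrow> (real \<Rightarrow> real \<Rightarrow> 'a::euclidean_space) \<Rightarrow> real \<Rightarrow> real \<Rightarrow> 'a set" where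
  "tangent_plane I J F t s = span {partial_t I F t s, partial_s J F t s}"

definition normal_part ::
  "real set \<Rightarrow> real set \<Rightarrow> (real \<Rightarrow> real \<Rightarrow> 'a::euclidean_space) \<Rightarrow> real \<Rightarrow> real \<Rightarrow> 'a \<Rightarrow> 'a" where
  "normal_part I J F t s v =
     (THE n. v - n \<in> tangent_plane I J F t s \<and> (\<forall>w\<in>tangent_plane I J F t s. orthogonal n w))"

definition first_form ::
  "real set \<Rightarrow> real set \<Rightarrow> (real \<Rightarrow> real \<Rightarrow> 'a::euclidean_space) \<Rightarrow> real \<Rightarrow> real
     \<Rightarrow> real \<times> real \<Rightarrow> real \<times> real \<Rightarrow> real" where
  "first_form I J F t s u v = dir_deriv I J F t s u \<bullet> dir_deriv I J F t s v"

text \<open>\<open>\<sigma>(u, v)\<close> is the normal part of the derivative in direction \<open>u\<close> of \<open>dF(v)\<close>, with \<open>v\<close>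
  extended to a field with constant components.\<close>

definition second_form ::
  "real set \<Rightarrow> real set \<Rightarrow> (real \<Rightarrow> real \<Rightarrow> 'a::euclidean_space) \<Rightarrow> real \<Rightarrow> real
     \<Rightarrow> real \<times> real \<Rightarrow> real \<times> real \<Rightarrow> 'a" where
  "second_form I J F t s u v =
     normal_part I J F t s (dir_deriv I J (\<lambda>x y. dir_deriv I J F x y v) t s u)"

text \<open>The trace of \<open>\<sigma>\<close> with respect to the induced metric (no factor 1/2), i.e. the sum of
  \<open>g\<^sup>i\<^sup>j \<sigma>\<^sub>i\<^sub>j\<close>, with the inverse of the 2x2 Gram matrix written out.\<close>

definition mean_curvature_vector ::
  "real set \<Rightarrow> real set \<Rightarrow> (real \<Rightarrow> real \<Rightarrow> 'a::euclidean_space) \<Rightarrow> real \<Rightarrow> real \<Rightarrow> 'a" where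
  "mean_curvature_vector I J F t s =
     (let e1 = (1, 0); e2 = (0, 1);
          g = first_form I J F t s; \<sigma> = second_form I J F t s
      in (1 / (g e1 e1 * g e2 e2 - g e1 e2 * g e2 e1)) *\<^sub>R
           (g e2 e2 *\<^sub>R \<sigma> e1 e1 - g e1 e2 *\<^sub>R \<sigma> e1 e2 - g e2 e1 *\<^sub>R \<sigma> e2 e1 + g e1 e1 *\<^sub>R \<sigma> e2 e2))"

definition normal_connection ::
  "real set \<Rightarrow> real set \<Rightarrow> (real \<Rightarrow> real \<Rightarrow> 'a::euclidean_space) \<Rightarrow> (real \<Rightarrow> real \<Rightarrow> 'a)
     \<Rightarrow> real \<Rightarrow> real \<Rightarrow> real \<times> real \<Rightarrow> 'a" where
  "normal_connection I J F \<xi> t s u = normal_part I J F t s (dir_deriv I J \<xi> t s u)"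

definition parallel_mean_curvature ::
  "real set \<Rightarrow> real set \<Rightarrow> (real \<Rightarrow> real \<Rightarrow> 'a::euclidean_space) \<Rightarrow> bool" where
  "parallel_mean_curvature I J F \<longleftrightarrow>
     (\<forall>t\<in>I. \<forall>s\<in>J. \<forall>u. normal_connection I J F (mean_curvature_vector I J F) t s u = 0)"

definition non_null_mean_curvature ::
  "real set \<Rightarrow> real set \<Rightarrow> (real \<Rightarrow> real \<Rightarrow> 'a::euclidean_space) \<Rightarrow> bool" where
  "non_null_mean_curvature I J F \<longleftrightarrow> (\<exists>t\<in>I. \<exists>s\<in>J. mean_curvature_vector I J F t s \<noteq> 0)"

end

theory Submission
  imports Defs
begin

text \<open>Put \<open>X = \<Phi>\<^sub>t\<close>, \<open>Y = \<Phi>\<^sub>s\<close> and \<open>L = \<bar>\<alpha>\<bar>\<^sup>2 + \<bar>\<omega>\<bar>\<^sup>2\<close>. The fields \<open>X\<close> and \<open>Y\<close> are Hermitian orthogonal,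
  so the normal plane is spanned by \<open>\<i> X\<close> and \<open>\<i> Y\<close>, and \<open>H = (\<i> / \<surd>L) (k X / \<bar>X\<bar> + l Y / \<bar>Y\<bar>)\<close> with
  \<open>k\<close>, \<open>l\<close> the signed curvatures of the two curves. With primes for arc length derivatives and
  \<open>P = (\<bar>\<alpha>\<bar>\<^sup>2)' / 2\<close>, \<open>Q = (\<bar>\<omega>\<bar>\<^sup>2)' / 2\<close>, the mean curvature is parallel iff \<open>k' = (k P - l Q) / L\<close>,
  \<open>l' = (l Q - k P) / L\<close> and \<open>l P + k Q = 0\<close>. Hence \<open>k' = - l'\<close> depends neither on \<open>t\<close> nor on \<open>s\<close>.
  If it is zero, then \<open>k P = l Q\<close>, so \<open>(k\<^sup>2 + l\<^sup>2) P = (k\<^sup>2 + l\<^sup>2) Q = 0\<close> with a constant \<open>k\<^sup>2 + l\<^sup>2 > 0\<close>. If it is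
  not, the third equation makes \<open>P\<close> a constant multiple of \<open>k\<close>, which is incompatible with \<open>k'\<close> being a
  nonzero constant.\<close>

section \<open>Derivatives and integrals on an interval\<close>

text \<open>A connected set with more than one point has no isolated points. This makes derivatives
  within the interval unique, also at its endpoints.\<close>

lemma nondeg_interval_at_within_ne_bot:
  assumes "nondeg_interval I" "t \<in> I"
  shows "at t within I \<noteq> bot"
proof -
  have "connected I"
    using assms(1) by (simp add: nondeg_interval_def is_interval_connected_1)
  moreover have "I \<noteq> {x}" for x
    using assms(1) by (auto simp: nondeg_interval_def)
  ultimately show ?thesis
    using connected_imp_perfect[of I t] assms(2) by (simp add: trivial_limit_within)
qed

text \<open>Near \<open>t\<close> the interval coincides with a compact subinterval that contains
  \<open>c\<close>, and there \<open>interval_integral_FTC2\<close> applies.\<close>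

lemma interval_integral_has_vector_derivative:
  fixes f :: "real \<Rightarrow> 'a::euclidean_space"
  assumes "is_interval I" "continuous_on I f" "c \<in> I" "t \<in> I"
  shows "((\<lambda>u. LBINT y=c..u. f y) has_vector_derivative f t) (at t within I)"
proof -
  have sub: "{u..v} \<subseteq> I" if "u \<in> I" "v \<in> I" for u v
    using mem_is_interval_1_I[OF assms(1) that] by auto
  \<comment> \<open>If \<open>t\<close> is the left endpoint of \<open>I\<close>, then
    \<open>a = t\<close> already bounds \<open>I\<close> from below; otherwise \<open>a\<close> is
    any smaller point of \<open>I\<close>. The choice of \<open>b\<close> is symmetric.\<close>
  obtain a U where a: "a \<in> I" "a \<le> t" "open U" "t \<in> U" "I \<inter> U \<subseteq> {a..}"
  proof (cases "\<exists>a\<in>I. a < t")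
    case True
    then obtain a where "a \<in> I" "a < t" by blast
    then show ?thesis by (intro that[of a "{a<..}"]) auto
  next
    case False
    with assms(4) show ?thesis by (intro that[of t UNIV]) (auto simp: not_less)
  qed
  obtain b V where b: "b \<in> I" "t \<le> b" "open V" "t \<in> V" "I \<inter> V \<subseteq> {..b}"
  proof (cases "\<exists>b\<in>I. t < b")
    case True
    then obtain b where "b \<in> I" "t < b" by blast
    then show ?thesis by (intro that[of b "{..<b}"]) auto
  next
    case False
    with assms(4) show ?thesis by (intro that[of t UNIV]) (auto simp: not_less)
  qed
  let ?a = "min a c" and ?b = "max b c"
  have subI: "{?a..?b} \<subseteq> I"
    using sub a(1) b(1) assms(3) by (simp add: min_def max_def)
  have "((\<lambda>u. LBINT y=c..u. f y) has_vector_derivative f t) (at t within {?a..?b})"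
    using a(2) b(2) by (intro interval_integral_FTC2 continuous_on_subset[OF assms(2) subI]) auto
  moreover have "at t within {?a..?b} = at t within I"
  proof (rule at_within_nhd[of _ "U \<inter> V"])
    show "{?a..?b} \<inter> (U \<inter> V) - {t} = I \<inter> (U \<inter> V) - {t}"
      using subI a(5) b(5) by (auto simp: min_le_iff_disj le_max_iff_disj)
  qed (use a b in auto)
  ultimately show ?thesis by simp
qed

lemma vector_derivative_within_eq:
  assumes "nondeg_interval I" "t \<in> I" "\<And>x. x \<in> I \<Longrightarrow> f x = g x"
    and "(g has_vector_derivative d) (at t within I)"
  shows "vector_derivative f (at t within I) = d"
  using assms
  by (intro vector_derivative_within nondeg_interval_at_within_ne_bot
      has_vector_derivative_transform[of t I f g])

text \<open>Serves to differentiate an identity that is known on the interval only.\<close>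

lemma DERIV_within_unique:
  fixes f :: "real \<Rightarrow> real"
  assumes "nondeg_interval I" "t \<in> I" "\<And>x. x \<in> I \<Longrightarrow> f x = g x"
    and "(f has_real_derivative d) (at t within I)" "(g has_real_derivative e) (at t within I)"
  shows "d = e"
proof -
  have "(f has_vector_derivative e) (at t within I)"
    using assms has_vector_derivative_transform[of t I f g e]
    by (simp add: has_real_derivative_iff_has_vector_derivative)
  then show ?thesis
    using assms(1,2,4) vector_derivative_unique_within[OF nondeg_interval_at_within_ne_bot]
    by (auto simp: has_real_derivative_iff_has_vector_derivative)
qed

lemma DERIV_zero_on_interval_constant:
  fixes f :: "real \<Rightarrow> real"
  assumes "is_interval I" "\<And>t. t \<in> I \<Longrightarrow> (f has_real_derivative 0) (at t within I)"
    "t \<in> I" "t' \<in> I"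
  shows "f t = f t'"
  using has_field_derivative_zero_constant[of I f] assms by (metis is_interval_convex)

section \<open>Complex frames and the Hermitian product\<close>

text \<open>The coefficients are complex because, for a Lagrangian frame, their real parts give
  tangent vectors and their imaginary parts normal ones.\<close>

definition lin_comb :: "complex \<Rightarrow> complex \<Rightarrow> complex \<times> complex \<Rightarrow> complex \<times> complex \<Rightarrow> complex \<times> complex"
  where "lin_comb p q X Y = (p * fst X + q * fst Y, p * snd X + q * snd Y)"

definition hermitian :: "complex \<times> complex \<Rightarrow> complex \<times> complex \<Rightarrow> complex" where
  "hermitian X Y = fst X * cnj (fst Y) + snd X * cnj (snd Y)"

lemma inner_eq_Re_hermitian: "X \<bullet> Y = Re (hermitian X Y)"
  by (simp add: hermitian_def inner_prod_def inner_complex_def)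

lemma hermitian_lin_comb:
  "hermitian (lin_comb p q X Y) Z = p * hermitian X Z + q * hermitian Y Z"
  by (simp add: hermitian_def lin_comb_def algebra_simps)

lemma hermitian_cnj: "cnj (hermitian X Y) = hermitian Y X"
  by (simp add: hermitian_def algebra_simps)

lemma hermitian_self: "hermitian X X = of_real ((norm X)\<^sup>2)"
  by (simp add: hermitian_def norm_prod_def complex_norm_square flip: of_real_power)

lemma scaleR_lin_comb: "r *\<^sub>R lin_comb p q X Y = lin_comb (of_real r * p) (of_real r * q) X Y"
  by (simp add: lin_comb_def scaleR_conv_of_real algebra_simps)

lemma add_lin_comb: "lin_comb p q X Y + lin_comb p' q' X Y = lin_comb (p + p') (q + q') X Y"
  by (simp add: lin_comb_def algebra_simps)

lemma diff_lin_comb: "lin_comb p q X Y - lin_comb p' q' X Y = lin_comb (p - p') (q - q') X Y"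
  by (simp add: lin_comb_def algebra_simps)

lemma lin_comb_of_real: "lin_comb (of_real x) (of_real y) X Y = x *\<^sub>R X + y *\<^sub>R Y"
  by (simp add: lin_comb_def prod_eq_iff scaleR_conv_of_real)

text \<open>Hermitian products of the combination with \<open>X\<close> and with \<open>Y\<close>
  isolate the two coefficients.\<close>

lemma lin_comb_eq_0_iff:
  assumes "hermitian X Y = 0" "X \<noteq> 0" "Y \<noteq> 0"
  shows "lin_comb p q X Y = 0 \<longleftrightarrow> p = 0 \<and> q = 0"
proof
  assume *: "lin_comb p q X Y = 0"
  have "hermitian Y X = 0"
    using assms(1) hermitian_cnj[of X Y] by simp
  then have "p * of_real ((norm X)\<^sup>2) = 0" "q * of_real ((norm Y)\<^sup>2) = 0"
    using hermitian_lin_comb[of p q X Y X] hermitian_lin_comb[of p q X Y Y] assms(1) *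
    by (simp_all add: hermitian_self hermitian_def)
  then show "p = 0 \<and> q = 0" using assms(2,3) by simp
qed (simp add: lin_comb_def zero_prod_def)

lemma lin_comb_lin_comb:
  "lin_comb p q (lin_comb a b X Y) (lin_comb c d X Y) = lin_comb (p * a + q * c) (p * b + q * d) X Y"
  by (simp add: lin_comb_def algebra_simps)

lemma has_vector_derivative_lin_comb:
  assumes "(p has_vector_derivative p') (at t within S)" "(q has_vector_derivative q') (at t within S)"
    "(X has_vector_derivative X') (at t within S)" "(Y has_vector_derivative Y') (at t within S)"
  shows "((\<lambda>t. lin_comb (p t) (q t) (X t) (Y t)) has_vector_derivative
    lin_comb p' q' (X t) (Y t) + lin_comb (p t) (q t) X' Y') (at t within S)"
proof -
  have *: "((\<lambda>t. fst (X t)) has_vector_derivative fst X') (at t within S)"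
    "((\<lambda>t. fst (Y t)) has_vector_derivative fst Y') (at t within S)"
    "((\<lambda>t. snd (X t)) has_vector_derivative snd X') (at t within S)"
    "((\<lambda>t. snd (Y t)) has_vector_derivative snd Y') (at t within S)"
    using bounded_linear.has_vector_derivative[OF bounded_linear_fst]
      bounded_linear.has_vector_derivative[OF bounded_linear_snd] assms(3,4) by blast+
  show ?thesis
    unfolding lin_comb_def
    by (rule derivative_eq_intros assms * refl)+ (simp add: algebra_simps)
qed

section \<open>The normal projection\<close>

text \<open>Two candidates differ by a tangent vector that is orthogonal to the tangent plane, hence
  to itself.\<close>

lemma normal_part_eqI:
  assumes "v - n \<in> tangent_plane I J F t s" "\<And>w. w \<in> tangent_plane I J F t s \<Longrightarrow> orthogonal n w"
  shows "normal_part I J F t s v = n"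
  unfolding normal_part_def
proof (rule the_equality)
  fix n'
  assume n': "v - n' \<in> tangent_plane I J F t s \<and> (\<forall>w\<in>tangent_plane I J F t s. orthogonal n' w)"
  then have "(v - n) - (v - n') \<in> tangent_plane I J F t s"
    using assms(1) unfolding tangent_plane_def by (blast intro: span_diff)
  then have "n' - n \<in> tangent_plane I J F t s" by simp
  then have "(n' - n) \<bullet> (n' - n) = 0"
    using n' assms(2) by (auto simp: orthogonal_def inner_diff_left)
  then show "n' = n" by simp
qed (use assms in auto)

text \<open>The Lagrangian condition: multiplication by \<open>\<i>\<close> maps the tangent plane onto the normal one.\<close>

lemma normal_part_lin_comb:
  assumes X: "partial_t I F t s = X" and Y: "partial_s J F t s = Y" and "hermitian X Y = 0"
  shows "normal_part I J F t s (lin_comb p q X Y) = lin_comb (\<i> * Im p) (\<i> * Im q) X Y"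
proof (rule normal_part_eqI)
  have T: "tangent_plane I J F t s = span {X, Y}"
    by (simp add: tangent_plane_def X Y)
  have "lin_comb p q X Y - lin_comb (\<i> * Im p) (\<i> * Im q) X Y
      = lin_comb (of_real (Re p)) (of_real (Re q)) X Y"
    unfolding diff_lin_comb
    by (intro arg_cong2[where f = "\<lambda>p q. lin_comb p q X Y"]) (simp_all add: complex_eq_iff)
  also have "\<dots> \<in> span {X, Y}"
    by (simp add: lin_comb_of_real span_add span_scale span_base)
  finally show "lin_comb p q X Y - lin_comb (\<i> * Im p) (\<i> * Im q) X Y \<in> tangent_plane I J F t s"
    by (simp add: T)
  have "hermitian Y X = 0"
    using assms(3) hermitian_cnj[of X Y] by simp
  then have "orthogonal (lin_comb (\<i> * Im p) (\<i> * Im q) X Y) X"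
    "orthogonal (lin_comb (\<i> * Im p) (\<i> * Im q) X Y) Y"
    using assms(3)
    by (simp_all add: orthogonal_def inner_eq_Re_hermitian hermitian_lin_comb hermitian_self)
  then show "orthogonal (lin_comb (\<i> * Im p) (\<i> * Im q) X Y) w"
    if "w \<in> tangent_plane I J F t s" for w
    using that unfolding T by (intro orthogonal_to_span[of w "{X, Y}"]) (auto simp: orthogonal_commute)
qed

section \<open>Planar curves\<close>

text \<open>Three derivatives appear because the curvature takes two and parallelism of the mean
  curvature vector differentiates it once more.\<close>

locale regular_plane_curve =
  fixes I :: "real set" and c c1 c2 c3 :: "real \<Rightarrow> complex"
  assumes interval: "nondeg_interval I"
    and deriv_c: "\<And>t. t \<in> I \<Longrightarrow> (c has_vector_derivative c1 t) (at t within I)"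
    and deriv_c1: "\<And>t. t \<in> I \<Longrightarrow> (c1 has_vector_derivative c2 t) (at t within I)"
    and deriv_c2: "\<And>t. t \<in> I \<Longrightarrow> (c2 has_vector_derivative c3 t) (at t within I)"
    and c_nonzero: "\<And>t. t \<in> I \<Longrightarrow> c t \<noteq> 0"
    and c1_nonzero: "\<And>t. t \<in> I \<Longrightarrow> c1 t \<noteq> 0"
begin

definition speed2 :: "real \<Rightarrow> real" where "speed2 t = (cmod (c1 t))\<^sup>2"

text \<open>The logarithmic derivative of the speed.\<close>

definition accel :: "real \<Rightarrow> real" where "accel t = Re (c2 t * cnj (c1 t)) / speed2 t"

text \<open>The signed curvature is \<open>curv * cmod c1\<close>; dividing by the speed keeps square roots out.\<close>

definition curv :: "real \<Rightarrow> real" where "curv t = Im (c2 t * cnj (c1 t)) / (speed2 t)\<^sup>2"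

text \<open>The derivative of \<open>curv\<close>: in the numerator the term
  \<open>c2 * cnj c2\<close> is real and drops out, and the denominator, the fourth power of the
  speed, has logarithmic derivative \<open>4 * accel\<close>.\<close>

definition curv' :: "real \<Rightarrow> real" where
  "curv' t = Im (c3 t * cnj (c1 t)) / (speed2 t)\<^sup>2 - 4 * curv t * accel t"

text \<open>The arc length derivative of the signed curvature.\<close>

definition curv_arc' :: "real \<Rightarrow> real" where "curv_arc' t = curv' t + curv t * accel t"

text \<open>Up to the factor \<open>(cmod c)^2\<close>, \<open>radial\<close> and
  \<open>angular\<close> are the real and imaginary parts of \<open>c1 / c\<close>;
  \<open>angular\<close> is the angular momentum about the origin.\<close>

definition radial :: "real \<Rightarrow> real" where "radial t = Re (c1 t * cnj (c t))"

definition angular :: "real \<Rightarrow> real" where "angular t = Im (c1 t * cnj (c t))"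

lemma speed2_pos: "t \<in> I \<Longrightarrow> speed2 t > 0"
  by (simp add: speed2_def c1_nonzero)

text \<open>The Frenet equation in an arbitrary parameter: after multiplication by
  \<open>cnj c1\<close> it reduces to the definitions of \<open>accel\<close> and
  \<open>curv\<close>.\<close>

lemma c2_eq:
  assumes "t \<in> I"
  shows "c2 t = Complex (accel t) (curv t * speed2 t) * c1 t"
proof -
  have "c2 t * cnj (c1 t) = Complex (accel t) (curv t * speed2 t) * of_real (speed2 t)"
    using speed2_pos[OF assms] by (simp add: accel_def curv_def complex_eq_iff power2_eq_square)
  also have "\<dots> = Complex (accel t) (curv t * speed2 t) * c1 t * cnj (c1 t)"
    by (simp add: speed2_def complex_norm_square flip: of_real_power)
  finally show ?thesis using c1_nonzero[OF assms] by simp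
qed

lemma DERIV_norm2:
  assumes "t \<in> I"
  shows "((\<lambda>t. (cmod (c t))\<^sup>2) has_real_derivative 2 * radial t) (at t within I)"
  using deriv_c[OF assms] unfolding cmod_power2 radial_def
  by (auto intro!: derivative_eq_intros simp: algebra_simps)

lemma DERIV_speed2:
  assumes "t \<in> I"
  shows "(speed2 has_real_derivative 2 * speed2 t * accel t) (at t within I)"
proof -
  have "((\<lambda>t. (cmod (c1 t))\<^sup>2) has_real_derivative 2 * Re (c2 t * cnj (c1 t))) (at t within I)"
    using deriv_c1[OF assms] unfolding cmod_power2
    by (auto intro!: derivative_eq_intros simp: algebra_simps)
  moreover have "Re (c2 t * cnj (c1 t)) = speed2 t * accel t"
    unfolding speed2_def cmod_power2
    by (subst c2_eq[OF assms]) (simp add: algebra_simps power2_eq_square)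
  ultimately show ?thesis by (simp only: speed2_def[abs_def] mult.assoc)
qed

text \<open>Substituting \<open>c2_eq\<close> brings back \<open>radial\<close> and
  \<open>angular\<close>, so the two satisfy a linear system; \<open>c1 * cnj c1\<close> is real and
  therefore enters only here.\<close>

lemma DERIV_radial:
  assumes "t \<in> I"
  shows "(radial has_real_derivative
    accel t * radial t - curv t * speed2 t * angular t + speed2 t) (at t within I)"
proof -
  have "(radial has_real_derivative Re (c2 t * cnj (c t) + c1 t * cnj (c1 t))) (at t within I)"
    using deriv_c[OF assms] deriv_c1[OF assms]
    unfolding radial_def[abs_def]
    by (auto intro!: derivative_eq_intros simp: algebra_simps)
  moreover have "Re (c2 t * cnj (c t) + c1 t * cnj (c1 t))
      = accel t * radial t - curv t * speed2 t * angular t + speed2 t"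
    unfolding radial_def angular_def
    by (subst c2_eq[OF assms], subst (3) speed2_def)
      (unfold cmod_power2, simp add: algebra_simps power2_eq_square)
  ultimately show ?thesis by simp
qed

lemma DERIV_angular:
  assumes "t \<in> I"
  shows "(angular has_real_derivative
    accel t * angular t + curv t * speed2 t * radial t) (at t within I)"
proof -
  have "(angular has_real_derivative Im (c2 t * cnj (c t) + c1 t * cnj (c1 t))) (at t within I)"
    using deriv_c[OF assms] deriv_c1[OF assms]
    unfolding angular_def[abs_def]
    by (auto intro!: derivative_eq_intros simp: algebra_simps)
  moreover have "Im (c2 t * cnj (c t) + c1 t * cnj (c1 t))
      = accel t * angular t + curv t * speed2 t * radial t"
    by (subst c2_eq[OF assms])
      (simp add: radial_def angular_def algebra_simps)
  ultimately show ?thesis by simp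
qed

lemma DERIV_curv:
  assumes "t \<in> I"
  shows "(curv has_real_derivative curv' t) (at t within I)"
proof -
  have "((\<lambda>t. Im (c2 t * cnj (c1 t))) has_real_derivative Im (c3 t * cnj (c1 t))) (at t within I)"
    using deriv_c1[OF assms] deriv_c2[OF assms]
    by (auto intro!: derivative_eq_intros simp: algebra_simps)
  from DERIV_divide[OF this DERIV_power[OF DERIV_speed2[OF assms], of 2]] speed2_pos[OF assms]
  show ?thesis
    unfolding curv_def[abs_def] curv'_def
    by (rule_tac DERIV_cong) (auto simp: field_simps power2_eq_square)
qed

text \<open>The function is the square of the signed curvature, which is therefore constant when
  \<open>curv_arc'\<close> vanishes identically.\<close>

lemma DERIV_curv2:
  assumes "t \<in> I"
  shows "((\<lambda>t. (curv t)\<^sup>2 * speed2 t) has_real_derivative 2 * curv t * speed2 t * curv_arc' t)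
    (at t within I)"
  using DERIV_curv[OF assms] DERIV_speed2[OF assms]
  by (auto intro!: derivative_eq_intros simp: curv_arc'_def algebra_simps power2_eq_square)

text \<open>Both sides are the squared modulus of \<open>c1 * cnj c\<close>. Consequently
  \<open>radial\<close> and \<open>angular\<close> have no common zero in \<open>I\<close>.\<close>

lemma radial2_angular2: "(radial t)\<^sup>2 + (angular t)\<^sup>2 = speed2 t * (cmod (c t))\<^sup>2"
  unfolding radial_def angular_def speed2_def cmod_power2 by (simp add: power2_eq_square algebra_simps)

text \<open>Twice \<open>radial\<close> is the derivative of the squared modulus of
  \<open>c\<close>, and a function on an interval is constant iff its derivative vanishes.\<close>

lemma centered_circle_iff: "centered_circle_on I c \<longleftrightarrow> (\<forall>t\<in>I. radial t = 0)"
proof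
  assume "centered_circle_on I c"
  then obtain r where r: "\<And>t. t \<in> I \<Longrightarrow> cmod (c t) = r"
    unfolding centered_circle_on_def by (auto simp: image_subset_iff)
  show "\<forall>t\<in>I. radial t = 0"
  proof
    fix t assume "t \<in> I"
    then have "2 * radial t = 0"
      by (intro DERIV_within_unique[OF interval _ _ DERIV_norm2, where g = "\<lambda>_. r\<^sup>2"]) (auto simp: r)
    then show "radial t = 0" by simp
  qed
next
  assume *: "\<forall>t\<in>I. radial t = 0"
  from interval obtain t0 where t0: "t0 \<in> I"
    unfolding nondeg_interval_def using interior_subset by blast
  have "(cmod (c t))\<^sup>2 = (cmod (c t0))\<^sup>2" if "t \<in> I" for t
  proof (rule DERIV_zero_on_interval_constant[OF _ _ that t0])
    show "((\<lambda>t. (cmod (c t))\<^sup>2) has_real_derivative 0) (at x within I)" if "x \<in> I" for x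
      using DERIV_norm2[OF that] * that by simp
  qed (use interval in \<open>simp add: nondeg_interval_def\<close>)
  then have "c ` I \<subseteq> sphere 0 (cmod (c t0))" by auto
  then show "centered_circle_on I c"
    unfolding centered_circle_on_def using c_nonzero[OF t0] by (intro exI[of _ "cmod (c t0)"]) simp
qed

text \<open>Differentiating \<open>radial = 0\<close> gives \<open>curv * angular = 1\<close>, and
  differentiating this gives \<open>angular * curv_arc' = 0\<close> with \<open>angular\<close>
  nonzero.\<close>

lemma circle_curv:
  assumes "\<And>t. t \<in> I \<Longrightarrow> radial t = 0" "t \<in> I"
  shows "curv t \<noteq> 0" "curv_arc' t = 0"
proof -
  have S: "curv t * angular t = 1" if "t \<in> I" for t
  proof -
    have "accel t * radial t - curv t * speed2 t * angular t + speed2 t = 0"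
      using assms(1) that by (intro DERIV_within_unique[OF interval _ _ DERIV_radial, where g = "\<lambda>_. 0"]) auto
    then have "speed2 t * (1 - curv t * angular t) = 0"
      using assms(1)[OF that] by (simp add: algebra_simps)
    then show ?thesis using speed2_pos[OF that] by simp
  qed
  show nz: "curv t \<noteq> 0" using S[OF assms(2)] by auto
  have "curv' t * angular t + (accel t * angular t + curv t * speed2 t * radial t) * curv t = 0"
    using assms(2) S
    by (intro DERIV_within_unique[OF interval _ _ DERIV_mult[OF DERIV_curv DERIV_angular], where g = "\<lambda>_. 1"]) auto
  then have "angular t * curv_arc' t = 0"
    using assms by (simp add: curv_arc'_def algebra_simps)
  then show "curv_arc' t = 0" using S[OF assms(2)] by auto
qed

text \<open>The proportionality says that \<open>m\<close> times the curvature is the tangential component of \<open>c\<close>.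
  Differentiating it twice gives that \<open>m\<close> times the fourth power of the curvature is constant, so
  \<open>m = 0\<close>; then both components of \<open>c\<close> vanish.\<close>

lemma radial_proportional_curv_contradiction:
  assumes d: "\<And>t. t \<in> I \<Longrightarrow> curv_arc' t = d" "d \<noteq> 0"
    and m: "\<And>t. t \<in> I \<Longrightarrow> radial t = m * curv t * speed2 t"
    and t0: "t0 \<in> I" "curv t0 \<noteq> 0"
  shows False
proof -
  have 1: "curv t * angular t = 1 - m * d" if "t \<in> I" for t
  proof -
    have "accel t * radial t - curv t * speed2 t * angular t + speed2 t =
      m * curv' t * speed2 t + m * curv t * (2 * speed2 t * accel t)"
      by (rule DERIV_within_unique[OF interval that m DERIV_radial[OF that]])
        (auto intro!: derivative_eq_intros DERIV_curv[OF that] DERIV_speed2[OF that])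
    then have "speed2 t * (1 - curv t * angular t - m * curv_arc' t) = 0"
      unfolding m[OF that] curv_arc'_def by (simp add: algebra_simps)
    then show ?thesis using speed2_pos[OF that] d(1)[OF that] by simp
  qed
  have 2: "d * angular t = - (m * curv t * (curv t * speed2 t)\<^sup>2)" if "t \<in> I" for t
  proof -
    have "curv' t * angular t + (accel t * angular t + curv t * speed2 t * radial t) * curv t = 0"
      by (rule DERIV_within_unique[OF interval that 1
            DERIV_mult[OF DERIV_curv[OF that] DERIV_angular[OF that]] DERIV_const])
    then have "curv_arc' t * angular t + m * curv t * (curv t * speed2 t)\<^sup>2 = 0"
      unfolding m[OF that] curv_arc'_def by (simp add: algebra_simps power2_eq_square)
    then show ?thesis using d(1)[OF that] by simp
  qed
  \<comment> \<open>The squared signed curvature.\<close>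
  define g where "g t = (curv t)\<^sup>2 * speed2 t" for t
  have 3: "m * (g t)\<^sup>2 = - d * (1 - m * d)" if "t \<in> I" for t
  proof -
    have "m * (g t)\<^sup>2 = curv t * (m * curv t * (curv t * speed2 t)\<^sup>2)"
      by (simp add: g_def power2_eq_square)
    also have "\<dots> = curv t * - (d * angular t)" using 2[OF that] by simp
    also have "\<dots> = - (d * (curv t * angular t))" by simp
    finally show ?thesis using 1[OF that] by simp
  qed
  \<comment> \<open>The right side of \<open>3\<close> is constant, so the left side has zero
    derivative; at \<open>t0\<close> every factor of that derivative other than \<open>m\<close> is
    nonzero.\<close>
  have "m * (2 * g t0 * (2 * curv t0 * speed2 t0 * curv_arc' t0)) = 0"
  proof (rule DERIV_within_unique[OF interval t0(1) 3 _ DERIV_const])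
    have "(g has_real_derivative 2 * curv t0 * speed2 t0 * curv_arc' t0) (at t0 within I)"
      using DERIV_curv2[OF t0(1)] by (simp add: g_def[abs_def])
    then show "((\<lambda>t. m * (g t)\<^sup>2) has_real_derivative
        m * (2 * g t0 * (2 * curv t0 * speed2 t0 * curv_arc' t0))) (at t0 within I)"
      by (auto intro!: derivative_eq_intros)
  qed
  then have "m = 0"
    using t0 speed2_pos[OF t0(1)] d by (simp add: g_def)
  then have "radial t0 = 0" "angular t0 = 0"
    using m[OF t0(1)] 2[OF t0(1)] d(2) by simp_all
  then show False
    using radial2_angular2[of t0] speed2_pos[OF t0(1)] c_nonzero[OF t0(1)] by simp
qed

end

section \<open>Solving the equations of parallel mean curvature\<close>

text \<open>Here \<open>k\<close> and \<open>l\<close> are signed curvatures divided by the speeds,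
  and \<open>P\<close> and \<open>Q\<close> are derivatives in the given parameters; this is why the
  third equation carries the squared speeds \<open>u\<close> and \<open>v\<close>.\<close>

lemma curvature_equations_imp_circles:
  assumes A: "regular_plane_curve I a a1 a2 a3" and W: "regular_plane_curve J w w1 w2 w3"
  defines "k \<equiv> regular_plane_curve.curv a1 a2" and "l \<equiv> regular_plane_curve.curv w1 w2"
    and "P \<equiv> regular_plane_curve.radial a a1" and "Q \<equiv> regular_plane_curve.radial w w1"
    and "k' \<equiv> regular_plane_curve.curv_arc' a1 a2 a3" and "l' \<equiv> regular_plane_curve.curv_arc' w1 w2 w3"
    and "v \<equiv> regular_plane_curve.speed2 a1" and "u \<equiv> regular_plane_curve.speed2 w1"
  assumes eqs:
    "\<And>t s. t \<in> I \<Longrightarrow> s \<in> J \<Longrightarrow> k' t = (k t * P t - l s * Q s) / L t s"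
    "\<And>t s. t \<in> I \<Longrightarrow> s \<in> J \<Longrightarrow> l' s = (l s * Q s - k t * P t) / L t s"
    "\<And>t s. t \<in> I \<Longrightarrow> s \<in> J \<Longrightarrow> l s * P t * u s + k t * Q s * v t = 0"
    and L: "\<And>t s. t \<in> I \<Longrightarrow> s \<in> J \<Longrightarrow> L t s \<noteq> 0"
    and p0: "t0 \<in> I" "s0 \<in> J" "k t0 \<noteq> 0 \<or> l s0 \<noteq> 0"
  shows "(\<forall>t\<in>I. P t = 0) \<and> (\<forall>s\<in>J. Q s = 0)"
proof -
  interpret A: regular_plane_curve I a a1 a2 a3 by fact
  interpret W: regular_plane_curve J w w1 w2 w3 by fact
  define d where "d = k' t0"
  \<comment> \<open>The sum of the first two equations separates the variables: \<open>k'\<close>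
    depends on \<open>t\<close> alone and \<open>l'\<close> on \<open>s\<close> alone, so both are
    constant.\<close>
  have sum0: "k' t + l' s = 0" if "t \<in> I" "s \<in> J" for t s
    using eqs(1,2)[OF that] by (simp add: add_divide_distrib [symmetric])
  have k': "k' t = d" if "t \<in> I" for t
    using sum0[OF that p0(2)] sum0[OF p0(1,2)] by (simp add: d_def)
  have l': "l' s = - d" if "s \<in> J" for s
    using sum0[OF p0(1) that] by (simp add: d_def)
  have "d = 0"
  proof (rule ccontr)
    assume "d \<noteq> 0"
    \<comment> \<open>If \<open>l\<close> vanished identically, so would its derivative and with it
      \<open>l'\<close>, which equals \<open>- d\<close>. The same argument yields a point with
      \<open>k\<close> nonzero.\<close>
    have "\<exists>s\<in>J. l s \<noteq> 0"
    proof (rule ccontr)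
      assume "\<not> ?thesis"
      then have l0: "\<And>s. s \<in> J \<Longrightarrow> W.curv s = 0" by (auto simp: l_def)
      then have "W.curv' s0 = 0"
        by (intro DERIV_within_unique[OF W.interval p0(2) _ W.DERIV_curv[OF p0(2)], where g = "\<lambda>_. 0"]) auto
      then show False
        using l'[OF p0(2)] l0[OF p0(2)] \<open>d \<noteq> 0\<close> by (simp add: l'_def W.curv_arc'_def)
    qed
    then obtain s where s: "s \<in> J" "l s \<noteq> 0" by blast
    have "\<exists>t\<in>I. k t \<noteq> 0"
    proof (rule ccontr)
      assume "\<not> ?thesis"
      then have k0: "\<And>t. t \<in> I \<Longrightarrow> A.curv t = 0" by (auto simp: k_def)
      then have "A.curv' t0 = 0"
        by (intro DERIV_within_unique[OF A.interval p0(1) _ A.DERIV_curv[OF p0(1)], where g = "\<lambda>_. 0"]) auto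
      then show False
        using k'[OF p0(1)] k0[OF p0(1)] \<open>d \<noteq> 0\<close> by (simp add: k'_def A.curv_arc'_def)
    qed
    then obtain t where t: "t \<in> I" "k t \<noteq> 0" by blast
    have u: "u s > 0" unfolding u_def by (rule W.speed2_pos[OF s(1)])
    \<comment> \<open>With \<open>s\<close> fixed, the third equation makes \<open>P\<close>
      proportional to \<open>k * v\<close> with a factor that does not depend on
      \<open>x\<close>.\<close>
    have "P x = - (Q s / (l s * u s)) * k x * v x" if "x \<in> I" for x
    proof -
      have "P x * (l s * u s) = - (Q s * k x * v x)"
        using eqs(3)[OF that s(1)] by (simp add: algebra_simps)
      then have "P x = - (Q s * k x * v x) / (l s * u s)"
        using s(2) u by (metis nonzero_eq_divide_eq mult_eq_0_iff less_irrefl)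
      then show ?thesis by simp
    qed
    then show False
      using A.radial_proportional_curv_contradiction[of d "- (Q s / (l s * u s))" t] k' t \<open>d \<noteq> 0\<close>
      by (simp add: k'_def k_def P_def v_def)
  qed
  \<comment> \<open>Now both squared signed curvatures are constant, so their sum is positive
    everywhere because it is positive at \<open>t0\<close>, \<open>s0\<close>.\<close>
  have const: "(k t)\<^sup>2 * v t = (k t0)\<^sup>2 * v t0" if "t \<in> I" for t
  proof (rule DERIV_zero_on_interval_constant[OF _ _ that p0(1)])
    show "((\<lambda>t. (k t)\<^sup>2 * v t) has_real_derivative 0) (at x within I)" if "x \<in> I" for x
      using A.DERIV_curv2[OF that] k'[OF that] \<open>d = 0\<close> by (simp add: k_def v_def k'_def)
  qed (use A.interval in \<open>simp add: nondeg_interval_def\<close>)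
  have const': "(l s)\<^sup>2 * u s = (l s0)\<^sup>2 * u s0" if "s \<in> J" for s
  proof (rule DERIV_zero_on_interval_constant[OF _ _ that p0(2)])
    show "((\<lambda>s. (l s)\<^sup>2 * u s) has_real_derivative 0) (at x within J)" if "x \<in> J" for x
      using W.DERIV_curv2[OF that] l'[OF that] \<open>d = 0\<close> by (simp add: l_def u_def l'_def)
  qed (use W.interval in \<open>simp add: nondeg_interval_def\<close>)
  have "P t = 0 \<and> Q s = 0" if "t \<in> I" "s \<in> J" for t s
  proof -
    have "v t0 > 0" "u s0 > 0"
      using A.speed2_pos[OF p0(1)] W.speed2_pos[OF p0(2)] by (simp_all add: u_def v_def)
    moreover have "(k t)\<^sup>2 * v t + (l s)\<^sup>2 * u s = (k t0)\<^sup>2 * v t0 + (l s0)\<^sup>2 * u s0"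
      using const[OF that(1)] const'[OF that(2)] by simp
    ultimately have pos: "(k t)\<^sup>2 * v t + (l s)\<^sup>2 * u s \<noteq> 0"
      using p0(3) by (simp add: add_nonneg_eq_0_iff)
    \<comment> \<open>The equations \<open>k P - l Q = 0\<close> and
      \<open>l u P + k v Q = 0\<close> form a linear system in \<open>P\<close> and \<open>Q\<close>
      whose determinant is the nonzero quantity in \<open>pos\<close>.\<close>
    have e1: "k t * P t = l s * Q s"
      using eqs(1)[OF that] k'[OF that(1)] \<open>d = 0\<close> L[OF that] by simp
    have "Q s * ((k t)\<^sup>2 * v t + (l s)\<^sup>2 * u s) = k t * (k t * Q s * v t) + l s * u s * (l s * Q s)"
      by (simp add: power2_eq_square algebra_simps)
    also have "\<dots> = k t * (l s * P t * u s + k t * Q s * v t)"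
      unfolding e1[symmetric] by (simp add: algebra_simps)
    finally have Q: "Q s = 0" using eqs(3)[OF that] pos by simp
    have "P t * ((k t)\<^sup>2 * v t + (l s)\<^sup>2 * u s) = k t * v t * (k t * P t) + l s * (l s * P t * u s)"
      by (simp add: power2_eq_square algebra_simps)
    also have "\<dots> = l s * (l s * P t * u s + k t * Q s * v t)"
      unfolding e1 by (simp add: algebra_simps)
    finally have "P t = 0" using eqs(3)[OF that] pos by simp
    then show ?thesis using Q by simp
  qed
  then show ?thesis using p0 by blast
qed

section \<open>The immersion\<close>

text \<open>The frame expansion of the second derivative of the immersion along one of the curves; the
  capital letters stand for complex conjugates.\<close>

lemma frame_identity:
  fixes a A a1 A1 w W w1 z l :: complex
  assumes "l = a * A + w * W" "l \<noteq> 0" "w1 \<noteq> 0"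
  shows "z * a1 * A + a1 * A1 = (z + a * A1 / l) * (a1 * A) + w * (a1 * A1) / (l * w1) * (w1 * W)"
    and "z * a1 * w = (z + a * A1 / l) * (a1 * w) - w * (a1 * A1) / (l * w1) * (a * w1)"
proof -
  have "a * A1 / l * (a1 * A) + w * (a1 * A1) / (l * w1) * (w1 * W) = (a * A + w * W) * (a1 * A1) / l"
    using assms(3) by (simp add: add_divide_distrib algebra_simps)
  also have "\<dots> = a1 * A1" using assms(2) by (simp add: assms(1)[symmetric])
  finally show "z * a1 * A + a1 * A1 = (z + a * A1 / l) * (a1 * A) + w * (a1 * A1) / (l * w1) * (w1 * W)"
    by (simp only: distrib_right mult.assoc add.assoc)
  show "z * a1 * w = (z + a * A1 / l) * (a1 * w) - w * (a1 * A1) / (l * w1) * (a * w1)"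
    using assms(3) by (simp add: algebra_simps)
qed

locale curve_pair =
  A: regular_plane_curve I a a1 a2 a3 + W: regular_plane_curve J w w1 w2 w3
  for I a a1 a2 a3 J w w1 w2 w3 +
  fixes t0 s0 :: real
  assumes t0: "t0 \<in> I" and s0: "s0 \<in> J"
begin

abbreviation \<Phi> :: "real \<Rightarrow> real \<Rightarrow> complex \<times> complex" where
  "\<Phi> \<equiv> curve_star I J t0 s0 a w"

definition X :: "real \<Rightarrow> real \<Rightarrow> complex \<times> complex" where
  "X t s = (- (a1 t * cnj (a t)), a1 t * w s)"

definition Y :: "real \<Rightarrow> real \<Rightarrow> complex \<times> complex" where
  "Y t s = (w1 s * cnj (w s), a t * w1 s)"

text \<open>The conformal factor of the induced metric relative to the product metric of the two
  curves.\<close>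

definition L :: "real \<Rightarrow> real \<Rightarrow> real" where
  "L t s = (cmod (a t))\<^sup>2 + (cmod (w s))\<^sup>2"

lemma L_pos: "t \<in> I \<Longrightarrow> L t s > 0"
  by (simp add: L_def A.c_nonzero add_pos_nonneg)

section \<open>The coordinate frame of the immersion\<close>

text \<open>The fundamental theorem handles the first component: on \<open>I\<close> the integrand
  agrees with \<open>a1 * cnj a\<close>, which is continuous.\<close>

lemma deriv_Phi_t:
  assumes "t \<in> I"
  shows "((\<lambda>x. \<Phi> x s) has_vector_derivative X t s) (at t within I)"
proof -
  let ?f = "\<lambda>x. vector_derivative a (at x within I) * cnj (a x)"
  have f: "?f x = a1 x * cnj (a x)" if "x \<in> I" for x
    using vector_derivative_within_eq[OF A.interval that refl A.deriv_c[OF that]] by simp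
  have "continuous_on I (\<lambda>x. a1 x * cnj (a x))"
    using continuous_on_vector_derivative[OF A.deriv_c] continuous_on_vector_derivative[OF A.deriv_c1]
    by (intro continuous_intros)
  then have "continuous_on I ?f" by (subst continuous_on_cong[OF refl f])
  then have "((\<lambda>x. LBINT y=t0..x. ?f y) has_vector_derivative ?f t) (at t within I)"
    using A.interval t0 assms by (intro interval_integral_has_vector_derivative) (simp_all add: nondeg_interval_def)
  then have "((\<lambda>x. LBINT y=t0..x. ?f y) has_vector_derivative a1 t * cnj (a t)) (at t within I)"
    by (simp add: f assms)
  then show ?thesis
    unfolding curve_star_def X_def
    by (auto intro!: derivative_eq_intros A.deriv_c assms)
qed

lemma deriv_Phi_s:
  assumes "s \<in> J"
  shows "((\<lambda>y. \<Phi> t y) has_vector_derivative Y t s) (at s within J)"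
proof -
  let ?f = "\<lambda>y. vector_derivative w (at y within J) * cnj (w y)"
  have f: "?f y = w1 y * cnj (w y)" if "y \<in> J" for y
    using vector_derivative_within_eq[OF W.interval that refl W.deriv_c[OF that]] by simp
  have "continuous_on J (\<lambda>y. w1 y * cnj (w y))"
    using continuous_on_vector_derivative[OF W.deriv_c] continuous_on_vector_derivative[OF W.deriv_c1]
    by (intro continuous_intros)
  then have "continuous_on J ?f" by (subst continuous_on_cong[OF refl f])
  then have "((\<lambda>y. LBINT x=s0..y. ?f x) has_vector_derivative ?f s) (at s within J)"
    using W.interval s0 assms by (intro interval_integral_has_vector_derivative) (simp_all add: nondeg_interval_def)
  then have "((\<lambda>y. LBINT x=s0..y. ?f x) has_vector_derivative w1 s * cnj (w s)) (at s within J)"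
    by (simp add: f assms)
  then show ?thesis
    unfolding curve_star_def Y_def
    by (auto intro!: derivative_eq_intros W.deriv_c assms)
qed

lemma partial_t_eqI:
  assumes "t \<in> I" "\<And>x. x \<in> I \<Longrightarrow> F x s = G x" "(G has_vector_derivative d) (at t within I)"
  shows "partial_t I F t s = d"
  unfolding partial_t_def by (rule vector_derivative_within_eq[OF A.interval assms])

lemma partial_s_eqI:
  assumes "s \<in> J" "\<And>y. y \<in> J \<Longrightarrow> F t y = G y" "(G has_vector_derivative d) (at s within J)"
  shows "partial_s J F t s = d"
  unfolding partial_s_def by (rule vector_derivative_within_eq[OF W.interval assms])

lemma partials_Phi:
  "t \<in> I \<Longrightarrow> partial_t I \<Phi> t s = X t s" "s \<in> J \<Longrightarrow> partial_s J \<Phi> t s = Y t s"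
  using partial_t_eqI[of t \<Phi> s "\<lambda>x. \<Phi> x s"] partial_s_eqI[of s \<Phi> t "\<Phi> t"] deriv_Phi_t deriv_Phi_s by blast+

lemma dir_deriv_Phi:
  assumes "t \<in> I" "s \<in> J"
  shows "dir_deriv I J \<Phi> t s (1, 0) = X t s" "dir_deriv I J \<Phi> t s (0, 1) = Y t s"
  using assms by (simp_all add: dir_deriv_def partials_Phi)

text \<open>The real part says that the coordinate lines are orthogonal, the imaginary part that the
  immersion is Lagrangian.\<close>

lemma hermitian_X_Y: "hermitian (X t s) (Y t s) = 0" "hermitian (Y t s) (X t s) = 0"
  by (simp_all add: hermitian_def X_def Y_def)

lemma normal_part_Phi:
  assumes "t \<in> I" "s \<in> J"
  shows "normal_part I J \<Phi> t s (lin_comb p q (X t s) (Y t s))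
    = lin_comb (\<i> * Im p) (\<i> * Im q) (X t s) (Y t s)"
  using assms by (intro normal_part_lin_comb partials_Phi hermitian_X_Y)

lemma inner_X_Y:
  "X t s \<bullet> X t s = L t s * A.speed2 t" "Y t s \<bullet> Y t s = L t s * W.speed2 s"
  "X t s \<bullet> Y t s = 0" "Y t s \<bullet> X t s = 0"
  by (simp_all add: inner_eq_Re_hermitian hermitian_X_Y hermitian_self)
    (simp_all add: norm_prod_def X_def Y_def L_def A.speed2_def W.speed2_def norm_mult power_mult_distrib algebra_simps)

lemma X_Y_nonzero:
  assumes "t \<in> I" "s \<in> J"
  shows "X t s \<noteq> 0" "Y t s \<noteq> 0"
  using inner_X_Y(1,2)[of t s] L_pos[OF assms(1), of s] A.speed2_pos[OF assms(1)] W.speed2_pos[OF assms(2)]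
  by auto

lemma frame_eq_0_iff:
  assumes "t \<in> I" "s \<in> J"
  shows "lin_comb p q (X t s) (Y t s) = 0 \<longleftrightarrow> p = 0 \<and> q = 0"
  using lin_comb_eq_0_iff[OF hermitian_X_Y(1) X_Y_nonzero[OF assms]] .

section \<open>Second derivatives in the frame\<close>

text \<open>The coefficients come from \<open>frame_identity\<close>. Their imaginary parts give the
  second fundamental form; their real parts become normal once multiplied by the imaginary
  coefficients of the mean curvature vector.\<close>

lemma deriv_X_t:
  assumes "t \<in> I" "s \<in> J"
  shows "((\<lambda>x. X x s) has_vector_derivative
    lin_comb (Complex (A.accel t + A.radial t / L t s) (A.curv t * A.speed2 t - A.angular t / L t s))
      (Complex (- (W.radial s * A.speed2 t / (L t s * W.speed2 s)))
         (W.angular s * A.speed2 t / (L t s * W.speed2 s))) (X t s) (Y t s)) (at t within I)"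
proof -
  have "((\<lambda>x. X x s) has_vector_derivative (- (a2 t * cnj (a t) + a1 t * cnj (a1 t)), a2 t * w s))
      (at t within I)"
    unfolding X_def using A.deriv_c[OF assms(1)] A.deriv_c1[OF assms(1)]
    by (auto intro!: derivative_eq_intros)
  moreover
  define z where "z = Complex (A.accel t) (A.curv t * A.speed2 t)"
  define l where "l = (of_real (L t s) :: complex)"
  have l: "l = a t * cnj (a t) + w s * cnj (w s)"
    by (simp add: l_def L_def complex_norm_square flip: of_real_power)
  have "l \<noteq> 0"
    using L_pos[OF assms(1), of s] by (simp add: l_def)
  have v: "of_real (A.speed2 t) = a1 t * cnj (a1 t)" "of_real (W.speed2 s) = w1 s * cnj (w1 s)"
    by (simp_all add: A.speed2_def W.speed2_def complex_norm_square flip: of_real_power)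
  have p: "Complex (A.accel t + A.radial t / L t s) (A.curv t * A.speed2 t - A.angular t / L t s)
      = z + a t * cnj (a1 t) / l"
    by (simp add: complex_eq_iff z_def l_def A.radial_def A.angular_def diff_divide_distrib add_divide_distrib mult.commute)
  \<comment> \<open>Dividing by \<open>w1\<close> amounts to multiplying by
    \<open>cnj w1 / speed2\<close>.\<close>
  have q: "Complex (- (W.radial s * A.speed2 t / (L t s * W.speed2 s)))
         (W.angular s * A.speed2 t / (L t s * W.speed2 s))
      = - (w s * (a1 t * cnj (a1 t)) / (l * w1 s))"
  proof -
    have "Complex (- (W.radial s * x)) (W.angular s * x) = - (w s * cnj (w1 s)) * of_real x" for x
      by (simp add: complex_eq_iff W.radial_def W.angular_def algebra_simps)
    from this[of "A.speed2 t / (L t s * W.speed2 s)"] show ?thesis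
      using W.c1_nonzero[OF assms(2)] by (simp add: v l_def)
  qed
  have "(- (a2 t * cnj (a t) + a1 t * cnj (a1 t)), a2 t * w s) =
    lin_comb (z + a t * cnj (a1 t) / l)
      (- (w s * (a1 t * cnj (a1 t)) / (l * w1 s))) (X t s) (Y t s)"
  proof -
    have "a2 t = z * a1 t" using A.c2_eq[OF assms(1)] by (simp add: z_def)
    then show ?thesis
      using frame_identity[OF l \<open>l \<noteq> 0\<close> W.c1_nonzero[OF assms(2)], of z "a1 t" "cnj (a1 t)"]
      by (simp add: lin_comb_def X_def Y_def)
  qed
  ultimately show ?thesis by (simp only: p q)
qed

text \<open>The same expansion with the two curves exchanged, for which the sum in \<open>l\<close>
  is commuted.\<close>

lemma deriv_Y_s:
  assumes "t \<in> I" "s \<in> J"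
  shows "((\<lambda>y. Y t y) has_vector_derivative
    lin_comb (Complex (- (A.radial t * W.speed2 s / (L t s * A.speed2 t)))
         (A.angular t * W.speed2 s / (L t s * A.speed2 t)))
      (Complex (W.accel s + W.radial s / L t s) (W.curv s * W.speed2 s - W.angular s / L t s))
      (X t s) (Y t s)) (at s within J)"
proof -
  have "((\<lambda>y. Y t y) has_vector_derivative (w2 s * cnj (w s) + w1 s * cnj (w1 s), a t * w2 s))
      (at s within J)"
    unfolding Y_def using W.deriv_c[OF assms(2)] W.deriv_c1[OF assms(2)]
    by (auto intro!: derivative_eq_intros)
  moreover
  define z where "z = Complex (W.accel s) (W.curv s * W.speed2 s)"
  define l where "l = (of_real (L t s) :: complex)"
  have l: "l = a t * cnj (a t) + w s * cnj (w s)"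
    by (simp add: l_def L_def complex_norm_square flip: of_real_power)
  have "l \<noteq> 0"
    using L_pos[OF assms(1), of s] by (simp add: l_def)
  have v: "of_real (A.speed2 t) = a1 t * cnj (a1 t)" "of_real (W.speed2 s) = w1 s * cnj (w1 s)"
    by (simp_all add: A.speed2_def W.speed2_def complex_norm_square flip: of_real_power)
  have q: "Complex (W.accel s + W.radial s / L t s) (W.curv s * W.speed2 s - W.angular s / L t s)
      = z + w s * cnj (w1 s) / l"
    by (simp add: complex_eq_iff z_def l_def W.radial_def W.angular_def diff_divide_distrib add_divide_distrib mult.commute)
  have p: "Complex (- (A.radial t * W.speed2 s / (L t s * A.speed2 t)))
         (A.angular t * W.speed2 s / (L t s * A.speed2 t))
      = - (a t * (w1 s * cnj (w1 s)) / (l * a1 t))"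
  proof -
    have "Complex (- (A.radial t * x)) (A.angular t * x) = - (a t * cnj (a1 t)) * of_real x" for x
      by (simp add: complex_eq_iff A.radial_def A.angular_def algebra_simps)
    from this[of "W.speed2 s / (L t s * A.speed2 t)"] show ?thesis
      using A.c1_nonzero[OF assms(1)] by (simp add: v l_def)
  qed
  have "(w2 s * cnj (w s) + w1 s * cnj (w1 s), a t * w2 s) =
    lin_comb (- (a t * (w1 s * cnj (w1 s)) / (l * a1 t)))
      (z + w s * cnj (w1 s) / l) (X t s) (Y t s)"
  proof -
    have "w2 s = z * w1 s" using W.c2_eq[OF assms(2)] by (simp add: z_def)
    then show ?thesis
      using frame_identity[OF l[unfolded add.commute[of "a t * cnj (a t)"]] \<open>l \<noteq> 0\<close>
          A.c1_nonzero[OF assms(1)], of z "w1 s" "cnj (w1 s)"]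
      by (simp add: lin_comb_def X_def Y_def mult.commute[of "a t"])
  qed
  ultimately show ?thesis by (simp only: p q)
qed

text \<open>The first component of \<open>X\<close> does not depend on \<open>s\<close>, nor that of
  \<open>Y\<close> on \<open>t\<close>, so both derivatives are \<open>(0, a1 * w1)\<close>;
  splitting by \<open>l = a * cnj a + w * cnj w\<close> gives the frame coefficients.\<close>

lemma deriv_mixed:
  assumes "t \<in> I" "s \<in> J"
  defines "M \<equiv> lin_comb (Complex (W.radial s / L t s) (W.angular s / L t s))
    (Complex (A.radial t / L t s) (A.angular t / L t s)) (X t s) (Y t s)"
  shows "((\<lambda>y. X t y) has_vector_derivative M) (at s within J)"
    "((\<lambda>x. Y x s) has_vector_derivative M) (at t within I)"
proof -
  define l where "l = (of_real (L t s) :: complex)"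
  have l: "l = a t * cnj (a t) + w s * cnj (w s)"
    by (simp add: l_def L_def complex_norm_square flip: of_real_power)
  have "l \<noteq> 0"
    using L_pos[OF assms(1), of s] by (simp add: l_def)
  have "Complex (W.radial s / L t s) (W.angular s / L t s) = w1 s * cnj (w s) / l"
    "Complex (A.radial t / L t s) (A.angular t / L t s) = a1 t * cnj (a t) / l"
    by (simp_all add: complex_eq_iff l_def A.radial_def A.angular_def W.radial_def W.angular_def)
  then have "M = lin_comb (w1 s * cnj (w s) / l) (a1 t * cnj (a t) / l) (X t s) (Y t s)"
    by (simp add: M_def)
  moreover have "a1 t * w1 s = (a t * cnj (a t)) * (a1 t * w1 s) / l + (w s * cnj (w s)) * (a1 t * w1 s) / l"
    unfolding add_divide_distrib[symmetric] distrib_right[symmetric] l[symmetric] using \<open>l \<noteq> 0\<close> by simp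
  ultimately have M: "M = (0, a1 t * w1 s)"
    by (simp add: lin_comb_def X_def Y_def algebra_simps)
  show "((\<lambda>y. X t y) has_vector_derivative M) (at s within J)"
    unfolding M X_def using W.deriv_c[OF assms(2)] by (auto intro!: derivative_eq_intros)
  show "((\<lambda>x. Y x s) has_vector_derivative M) (at t within I)"
    unfolding M Y_def using A.deriv_c[OF assms(1)] by (auto intro!: derivative_eq_intros)
qed

section \<open>Second fundamental form and mean curvature\<close>

text \<open>The normal projection keeps the imaginary parts found in \<open>deriv_X_t\<close> and
  \<open>deriv_Y_s\<close>. The frame is orthogonal, so the trace is built from these diagonal
  values.\<close>

lemma second_form_Phi:
  assumes "t \<in> I" "s \<in> J"
  shows "second_form I J \<Phi> t s (1, 0) (1, 0) =
      lin_comb (\<i> * of_real (A.curv t * A.speed2 t - A.angular t / L t s))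
        (\<i> * of_real (W.angular s * A.speed2 t / (L t s * W.speed2 s))) (X t s) (Y t s)"
    "second_form I J \<Phi> t s (0, 1) (0, 1) =
      lin_comb (\<i> * of_real (A.angular t * W.speed2 s / (L t s * A.speed2 t)))
        (\<i> * of_real (W.curv s * W.speed2 s - W.angular s / L t s)) (X t s) (Y t s)"
proof -
  have 1: "partial_t I (\<lambda>x y. dir_deriv I J \<Phi> x y (1, 0)) t s =
    lin_comb (Complex (A.accel t + A.radial t / L t s) (A.curv t * A.speed2 t - A.angular t / L t s))
      (Complex (- (W.radial s * A.speed2 t / (L t s * W.speed2 s)))
         (W.angular s * A.speed2 t / (L t s * W.speed2 s))) (X t s) (Y t s)"
    using assms by (intro partial_t_eqI[OF _ _ deriv_X_t] dir_deriv_Phi)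
  show "second_form I J \<Phi> t s (1, 0) (1, 0) =
      lin_comb (\<i> * of_real (A.curv t * A.speed2 t - A.angular t / L t s))
        (\<i> * of_real (W.angular s * A.speed2 t / (L t s * W.speed2 s))) (X t s) (Y t s)"
    unfolding second_form_def by (subst dir_deriv_def) (simp add: 1 normal_part_Phi[OF assms])
  have 2: "partial_s J (\<lambda>x y. dir_deriv I J \<Phi> x y (0, 1)) t s =
    lin_comb (Complex (- (A.radial t * W.speed2 s / (L t s * A.speed2 t)))
         (A.angular t * W.speed2 s / (L t s * A.speed2 t)))
      (Complex (W.accel s + W.radial s / L t s) (W.curv s * W.speed2 s - W.angular s / L t s))
      (X t s) (Y t s)"
    using assms by (intro partial_s_eqI[OF _ _ deriv_Y_s] dir_deriv_Phi)
  show "second_form I J \<Phi> t s (0, 1) (0, 1) =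
      lin_comb (\<i> * of_real (A.angular t * W.speed2 s / (L t s * A.speed2 t)))
        (\<i> * of_real (W.curv s * W.speed2 s - W.angular s / L t s)) (X t s) (Y t s)"
    unfolding second_form_def by (subst dir_deriv_def) (simp add: 2 normal_part_Phi[OF assms])
qed

text \<open>In the trace the \<open>angular\<close> terms of the two diagonal values cancel, and
  only the curvatures remain.\<close>

lemma mean_curvature_vector_Phi:
  assumes "t \<in> I" "s \<in> J"
  shows "mean_curvature_vector I J \<Phi> t s =
    lin_comb (\<i> * of_real (A.curv t / L t s)) (\<i> * of_real (W.curv s / L t s)) (X t s) (Y t s)"
proof -
  have nz: "L t s \<noteq> 0" "A.speed2 t \<noteq> 0" "W.speed2 s \<noteq> 0"
    using L_pos[OF assms(1), of s] A.speed2_pos[OF assms(1)] W.speed2_pos[OF assms(2)] by simp_all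
  show ?thesis
    unfolding mean_curvature_vector_def Let_def first_form_def dir_deriv_Phi[OF assms] inner_X_Y
      second_form_Phi[OF assms]
    unfolding scaleR_zero_left diff_zero add_0_right scaleR_lin_comb add_lin_comb mult_zero_left
    using nz by (intro arg_cong2[where f = "\<lambda>p q. lin_comb p q (X t s) (Y t s)"])
      (simp_all add: complex_eq_iff field_simps)
qed

lemma non_null_iff:
  "non_null_mean_curvature I J \<Phi> \<longleftrightarrow> (\<exists>t\<in>I. \<exists>s\<in>J. A.curv t \<noteq> 0 \<or> W.curv s \<noteq> 0)"
  unfolding non_null_mean_curvature_def
proof (intro bex_cong refl)
  fix t s assume "t \<in> I" "s \<in> J"
  then show "mean_curvature_vector I J \<Phi> t s \<noteq> 0 \<longleftrightarrow> A.curv t \<noteq> 0 \<or> W.curv s \<noteq> 0"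
    using L_pos[of t s] by (simp add: mean_curvature_vector_Phi frame_eq_0_iff)
qed

section \<open>The normal derivative of the mean curvature vector\<close>

text \<open>The product rule is applied to the coefficients and to the frame. Only imaginary parts
  are recorded, being what the normal projection retains.\<close>

lemma partials_mean_curvature_vector:
  assumes "t \<in> I" "s \<in> J"
  defines "P \<equiv> A.radial t" and "Q \<equiv> W.radial s" and "k \<equiv> A.curv t" and "l \<equiv> W.curv s"
  shows "\<exists>p q. partial_t I (mean_curvature_vector I J \<Phi>) t s = lin_comb p q (X t s) (Y t s)
      \<and> Im p = (A.curv_arc' t - (k * P - l * Q) / L t s) / L t s
      \<and> Im q = - (l * P * W.speed2 s + k * Q * A.speed2 t) / (W.speed2 s * (L t s)\<^sup>2)"
    "\<exists>p q. partial_s J (mean_curvature_vector I J \<Phi>) t s = lin_comb p q (X t s) (Y t s)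
      \<and> Im p = - (l * P * W.speed2 s + k * Q * A.speed2 t) / (A.speed2 t * (L t s)\<^sup>2)
      \<and> Im q = (W.curv_arc' s - (l * Q - k * P) / L t s) / L t s"
proof -
  have nz: "L t s \<noteq> 0" "A.speed2 t \<noteq> 0" "W.speed2 s \<noteq> 0"
    using L_pos[OF assms(1), of s] A.speed2_pos[OF assms(1)] W.speed2_pos[OF assms(2)] by simp_all
  have Lt: "((\<lambda>x. L x s) has_real_derivative 2 * P) (at t within I)"
    using DERIV_add[OF A.DERIV_norm2[OF assms(1)] DERIV_const] by (simp add: L_def P_def)
  have Ls: "((\<lambda>y. L t y) has_real_derivative 2 * Q) (at s within J)"
    using DERIV_add[OF DERIV_const W.DERIV_norm2[OF assms(2)]] by (simp add: L_def Q_def)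
  have dt: "((\<lambda>x. \<i> * of_real (A.curv x / L x s)) has_vector_derivative
      \<i> * of_real ((A.curv' t * L t s - k * (2 * P)) / (L t s * L t s))) (at t within I)"
    "((\<lambda>x. \<i> * of_real (W.curv s / L x s)) has_vector_derivative
      \<i> * of_real ((0 * L t s - l * (2 * P)) / (L t s * L t s))) (at t within I)"
    unfolding k_def l_def
    by (intro has_vector_derivative_mult_right has_vector_derivative_of_real DERIV_divide
        DERIV_const A.DERIV_curv Lt assms nz)+
  have ds: "((\<lambda>y. \<i> * of_real (A.curv t / L t y)) has_vector_derivative
      \<i> * of_real ((0 * L t s - k * (2 * Q)) / (L t s * L t s))) (at s within J)"
    "((\<lambda>y. \<i> * of_real (W.curv y / L t y)) has_vector_derivative
      \<i> * of_real ((W.curv' s * L t s - l * (2 * Q)) / (L t s * L t s))) (at s within J)"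
    unfolding k_def l_def
    by (intro has_vector_derivative_mult_right has_vector_derivative_of_real DERIV_divide
        DERIV_const W.DERIV_curv Ls assms nz)+
  show "\<exists>p q. partial_t I (mean_curvature_vector I J \<Phi>) t s = lin_comb p q (X t s) (Y t s)
      \<and> Im p = (A.curv_arc' t - (k * P - l * Q) / L t s) / L t s
      \<and> Im q = - (l * P * W.speed2 s + k * Q * A.speed2 t) / (W.speed2 s * (L t s)\<^sup>2)"
    \<comment> \<open>The witnesses stay schematic until the product rule determines them.\<close>
    apply (intro exI conjI)
      apply (rule partial_t_eqI[OF assms(1) _ has_vector_derivative_lin_comb[OF dt deriv_X_t[OF assms(1,2)]
            deriv_mixed(2)[OF assms(1,2)], unfolded lin_comb_lin_comb add_lin_comb]])
      apply (rule mean_curvature_vector_Phi[OF _ assms(2)], assumption)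
    using nz by (simp_all add: A.curv_arc'_def P_def Q_def k_def l_def field_simps power2_eq_square)
  show "\<exists>p q. partial_s J (mean_curvature_vector I J \<Phi>) t s = lin_comb p q (X t s) (Y t s)
      \<and> Im p = - (l * P * W.speed2 s + k * Q * A.speed2 t) / (A.speed2 t * (L t s)\<^sup>2)
      \<and> Im q = (W.curv_arc' s - (l * Q - k * P) / L t s) / L t s"
    apply (intro exI conjI)
      apply (rule partial_s_eqI[OF assms(2) _ has_vector_derivative_lin_comb[OF ds deriv_mixed(1)[OF assms(1,2)]
            deriv_Y_s[OF assms(1,2)], unfolded lin_comb_lin_comb add_lin_comb]])
      apply (rule mean_curvature_vector_Phi[OF assms(1)], assumption)
    using nz by (simp_all add: W.curv_arc'_def P_def Q_def k_def l_def field_simps power2_eq_square)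
qed

text \<open>By linearity in \<open>u\<close> it suffices to test the two coordinate directions. This
  gives four scalar conditions, two of which share their numerator.\<close>

lemma normal_connection_eq_0_iff:
  assumes "t \<in> I" "s \<in> J"
  defines "P \<equiv> A.radial t" and "Q \<equiv> W.radial s" and "k \<equiv> A.curv t" and "l \<equiv> W.curv s"
  shows "(\<forall>u. normal_connection I J \<Phi> (mean_curvature_vector I J \<Phi>) t s u = 0) \<longleftrightarrow>
    A.curv_arc' t = (k * P - l * Q) / L t s \<and> W.curv_arc' s = (l * Q - k * P) / L t s \<and>
    l * P * W.speed2 s + k * Q * A.speed2 t = 0"
proof -
  have nz: "L t s \<noteq> 0" "A.speed2 t \<noteq> 0" "W.speed2 s \<noteq> 0"
    using L_pos[OF assms(1), of s] A.speed2_pos[OF assms(1)] W.speed2_pos[OF assms(2)] by simp_all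
  obtain p q where pq: "partial_t I (mean_curvature_vector I J \<Phi>) t s = lin_comb p q (X t s) (Y t s)"
    "Im p = (A.curv_arc' t - (k * P - l * Q) / L t s) / L t s"
    "Im q = - (l * P * W.speed2 s + k * Q * A.speed2 t) / (W.speed2 s * (L t s)\<^sup>2)"
    using partials_mean_curvature_vector(1)[OF assms(1,2)] unfolding P_def Q_def k_def l_def by blast
  obtain p' q' where pq': "partial_s J (mean_curvature_vector I J \<Phi>) t s = lin_comb p' q' (X t s) (Y t s)"
    "Im p' = - (l * P * W.speed2 s + k * Q * A.speed2 t) / (A.speed2 t * (L t s)\<^sup>2)"
    "Im q' = (W.curv_arc' s - (l * Q - k * P) / L t s) / L t s"
    using partials_mean_curvature_vector(2)[OF assms(1,2)] unfolding P_def Q_def k_def l_def by blast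
  have "normal_connection I J \<Phi> (mean_curvature_vector I J \<Phi>) t s u = 0 \<longleftrightarrow>
      fst u * Im p + snd u * Im p' = 0 \<and> fst u * Im q + snd u * Im q' = 0" for u
    unfolding normal_connection_def dir_deriv_def pq(1) pq'(1) scaleR_lin_comb add_lin_comb
      normal_part_Phi[OF assms(1,2)] frame_eq_0_iff[OF assms(1,2)]
    by (simp flip: of_real_mult of_real_add)
  then have "(\<forall>u. normal_connection I J \<Phi> (mean_curvature_vector I J \<Phi>) t s u = 0) \<longleftrightarrow>
      (\<forall>u :: real \<times> real. fst u * Im p + snd u * Im p' = 0 \<and> fst u * Im q + snd u * Im q' = 0)"
    by simp
  also have "\<dots> \<longleftrightarrow> Im p = 0 \<and> Im p' = 0 \<and> Im q = 0 \<and> Im q' = 0"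
  proof
    assume "\<forall>u :: real \<times> real. fst u * Im p + snd u * Im p' = 0 \<and> fst u * Im q + snd u * Im q' = 0"
    from this[rule_format, of "(1, 0)"] this[rule_format, of "(0, 1)"]
    show "Im p = 0 \<and> Im p' = 0 \<and> Im q = 0 \<and> Im q' = 0" by simp
  qed simp
  also have "\<dots> \<longleftrightarrow> A.curv_arc' t = (k * P - l * Q) / L t s \<and> W.curv_arc' s = (l * Q - k * P) / L t s \<and>
      l * P * W.speed2 s + k * Q * A.speed2 t = 0"
    unfolding pq(2,3) pq'(2,3) using nz by auto
  finally show ?thesis .
qed

text \<open>For the converse, vanishing \<open>radial\<close> terms reduce the equations to
  \<open>curv_arc' = 0\<close> for both curves, which \<open>circle_curv\<close> provides together
  with nonzero curvature at the base point.\<close>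

theorem parallel_non_null_iff_circles:
  "parallel_mean_curvature I J \<Phi> \<and> non_null_mean_curvature I J \<Phi> \<longleftrightarrow>
    centered_circle_on I a \<and> centered_circle_on J w"
proof -
  have "(\<forall>t\<in>I. A.radial t = 0) \<and> (\<forall>s\<in>J. W.radial s = 0)"
    if par: "parallel_mean_curvature I J \<Phi>" and nn: "non_null_mean_curvature I J \<Phi>"
  proof -
    obtain t s where ts: "t \<in> I" "s \<in> J" "A.curv t \<noteq> 0 \<or> W.curv s \<noteq> 0"
      using nn unfolding non_null_iff by blast
    have *: "A.curv_arc' t = (A.curv t * A.radial t - W.curv s * W.radial s) / L t s \<and>
      W.curv_arc' s = (W.curv s * W.radial s - A.curv t * A.radial t) / L t s \<and>
      W.curv s * A.radial t * W.speed2 s + A.curv t * W.radial s * A.speed2 t = 0"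
      if "t \<in> I" "s \<in> J" for t s
      using par that normal_connection_eq_0_iff[OF that] unfolding parallel_mean_curvature_def by blast
    show ?thesis
    proof (rule curvature_equations_imp_circles[OF A.regular_plane_curve_axioms
          W.regular_plane_curve_axioms _ _ _ _ ts, where L = L])
      show "L t s \<noteq> 0" if "t \<in> I" for t s
        using L_pos[OF that, of s] by simp
    qed (use * in blast)+
  qed
  moreover have "parallel_mean_curvature I J \<Phi> \<and> non_null_mean_curvature I J \<Phi>"
    if "\<forall>t\<in>I. A.radial t = 0" "\<forall>s\<in>J. W.radial s = 0"
    unfolding non_null_iff parallel_mean_curvature_def
  proof (intro conjI ballI allI)
    fix t s u assume "t \<in> I" "s \<in> J"
    then have "\<forall>u. normal_connection I J \<Phi> (mean_curvature_vector I J \<Phi>) t s u = 0"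
      unfolding normal_connection_eq_0_iff[OF \<open>t \<in> I\<close> \<open>s \<in> J\<close>]
      using that A.circle_curv(2) W.circle_curv(2) by simp
    then show "normal_connection I J \<Phi> (mean_curvature_vector I J \<Phi>) t s u = 0" by blast
  next
    have "A.curv t0 \<noteq> 0" using A.circle_curv(1)[OF _ t0] that(1) by blast
    then show "\<exists>t\<in>I. \<exists>s\<in>J. A.curv t \<noteq> 0 \<or> W.curv s \<noteq> 0" using t0 s0 by blast
  qed
  ultimately show ?thesis
    unfolding A.centered_circle_iff W.centered_circle_iff by blast
qed

end

section \<open>The cylinder\<close>

text \<open>Regularity passes to the chosen derivative \<open>D 1\<close> because derivatives within
  a nondegenerate interval are unique.\<close>

lemma regular_curve_onE:
  assumes "nondeg_interval I" "regular_curve_on I c" "\<forall>t\<in>I. c t \<noteq> 0"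
  obtains c1 c2 c3 where "regular_plane_curve I c c1 c2 c3"
proof -
  obtain D where D: "D 0 = c"
    "\<And>n t. t \<in> I \<Longrightarrow> (D n has_vector_derivative D (Suc n) t) (at t within I)"
    using assms(2) unfolding regular_curve_on_def smooth_curve_on_def by blast
  have "D 1 t \<noteq> 0" if "t \<in> I" for t
    using assms(2) that vector_derivative_within_eq[OF assms(1) that refl D(2)[OF that, of 0]]
    unfolding regular_curve_on_def D(1) by auto
  then have "regular_plane_curve I c (D 1) (D 2) (D 3)"
    using D(2)[of _ 0] D(2)[of _ 1] D(2)[of _ 2] assms(1,3)
    by unfold_locales (simp_all add: D(1) numeral_2_eq_2 numeral_3_eq_3)
  then show ?thesis by (rule that)
qed

text \<open>The circle satisfies \<open>c' = \<i> * c\<close>, so the integrand is the constant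
  \<open>\<i> * r^2\<close>. It is used with \<open>r = R\<close> and with
  \<open>r = 1\<close>.\<close>

lemma interval_integral_circle:
  fixes r x :: real
  defines "c \<equiv> \<lambda>y. of_real r * exp (\<i> * of_real y)"
  shows "(LBINT y=0..x. vector_derivative c (at y within UNIV) * cnj (c y)) = \<i> * of_real (r\<^sup>2 * x)"
proof -
  have "(c has_vector_derivative \<i> * c y) (at y)" for y
    unfolding c_def by (rule has_vector_derivative_real_field[of "\<lambda>z. of_real r * exp (\<i> * z)"])
      (auto intro!: derivative_eq_intros)
  then have "vector_derivative c (at y within UNIV) = \<i> * c y" for y
    by (rule vector_derivative_at)
  moreover have "c y * cnj (c y) = of_real (r\<^sup>2)" for y
    unfolding complex_norm_square[symmetric] by (simp add: c_def norm_mult)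
  ultimately have f: "vector_derivative c (at y within UNIV) * cnj (c y) = \<i> * of_real (r\<^sup>2)" for y
    by (simp only: mult.assoc)
  have "(LBINT y=0..x. \<i> * of_real (r\<^sup>2)) = \<i> * of_real (r\<^sup>2 * x) - \<i> * of_real (r\<^sup>2 * 0)"
    \<comment> \<open>The lower limit is an extended real; it is rewritten as the image of the real
      number 0.\<close>
    unfolding zero_ereal_def
  proof (rule interval_integral_FTC_finite)
    show "((\<lambda>x. \<i> * of_real (r\<^sup>2 * x)) has_vector_derivative \<i> * of_real (r\<^sup>2)) (at y within S)" for y S
      by (intro has_vector_derivative_mult_right has_vector_derivative_of_real)
        (auto intro!: derivative_eq_intros)
  qed simp
  then show ?thesis unfolding f by simp
qed

lemma curve_star_circles:
  "curve_star UNIV UNIV 0 0 (\<lambda>t. exp (\<i> * complex_of_real t))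
      (\<lambda>s. complex_of_real R * exp (\<i> * complex_of_real s)) t s
    = (\<i> * complex_of_real (R\<^sup>2 * s - t), complex_of_real R * exp (\<i> * complex_of_real (s + t)))"
  using interval_integral_circle[of s R] interval_integral_circle[of t 1]
  by (simp add: curve_star_def exp_add algebra_simps zero_ereal_def)

lemma range_cylinder:
  fixes R :: real
  assumes "R > 0"
  shows "range (\<lambda>(t, s). (\<i> * complex_of_real (R\<^sup>2 * s - t), complex_of_real R * exp (\<i> * complex_of_real (s + t))))
    = range (\<lambda>x. \<i> * complex_of_real x) \<times> sphere 0 R" (is "range ?f = ?C")
proof
  show "range ?f \<subseteq> ?C"
    using assms by (auto simp: norm_mult simp del: of_real_diff of_real_mult)
  show "?C \<subseteq> range ?f"
  proof
    fix p assume "p \<in> ?C"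
    then obtain x z where p: "p = (\<i> * of_real x, z)" and z: "cmod z = R" by auto
    \<comment> \<open>The solution of the linear system \<open>R^2 * s - t = x\<close>,
      \<open>s + t = Arg z\<close>.\<close>
    define s t where "s = (x + Arg z) / (R\<^sup>2 + 1)" and "t = Arg z - s"
    have "z = of_real R * exp (\<i> * of_real (s + t))"
      using Arg_eq[of z] z assms by (auto simp: t_def)
    moreover have "s * (R\<^sup>2 + 1) = x + Arg z"
      using sum_power2_gt_zero_iff[of R 1] by (simp add: s_def)
    then have "R\<^sup>2 * s - t = x" by (simp add: t_def algebra_simps)
    ultimately have "p = ?f (t, s)" by (simp only: p prod.case)
    then show "p \<in> range ?f" by blast
  qed
qed

theorem corollary3p2:
  shows "(\<forall>(I\<^sub>1 :: real set) (I\<^sub>2 :: real set) (\<alpha> :: real \<Rightarrow> complex) (\<omega> :: real \<Rightarrow> complex) t\<^sub>0 s\<^sub>0.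
            nondeg_interval I\<^sub>1 \<longrightarrow> nondeg_interval I\<^sub>2 \<longrightarrow>
            regular_curve_on I\<^sub>1 \<alpha> \<longrightarrow> regular_curve_on I\<^sub>2 \<omega> \<longrightarrow>
            (\<forall>t\<in>I\<^sub>1. \<alpha> t \<noteq> 0) \<longrightarrow> (\<forall>s\<in>I\<^sub>2. \<omega> s \<noteq> 0) \<longrightarrow>
            t\<^sub>0 \<in> I\<^sub>1 \<longrightarrow> s\<^sub>0 \<in> I\<^sub>2 \<longrightarrow>
            (let \<Phi> = curve_star I\<^sub>1 I\<^sub>2 t\<^sub>0 s\<^sub>0 \<alpha> \<omega>
             in parallel_mean_curvature I\<^sub>1 I\<^sub>2 \<Phi> \<and> non_null_mean_curvature I\<^sub>1 I\<^sub>2 \<Phi>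
                \<longleftrightarrow> centered_circle_on I\<^sub>1 \<alpha> \<and> centered_circle_on I\<^sub>2 \<omega>))
       \<and> (\<forall>R::real. R > 0 \<longrightarrow>
            (let \<Phi> = curve_star UNIV UNIV 0 0
                       (\<lambda>t. exp (\<i> * complex_of_real t))
                       (\<lambda>s. complex_of_real R * exp (\<i> * complex_of_real s))
             in (\<forall>t s. \<Phi> t s = (\<i> * complex_of_real (R\<^sup>2 * s - t),
                                complex_of_real R * exp (\<i> * complex_of_real (s + t))))
                \<and> range (\<lambda>(t, s). \<Phi> t s) = range (\<lambda>x. \<i> * complex_of_real x) \<times> sphere 0 R))"
proof (intro conjI allI impI)
  fix I J :: "real set" and \<alpha> \<omega> :: "real \<Rightarrow> complex" and t0 s0
  assume "nondeg_interval I" "nondeg_interval J" "regular_curve_on I \<alpha>" "regular_curve_on J \<omega>"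
    "\<forall>t\<in>I. \<alpha> t \<noteq> 0" "\<forall>s\<in>J. \<omega> s \<noteq> 0" and base: "t0 \<in> I" "s0 \<in> J"
  then obtain a1 a2 a3 w1 w2 w3
    where "regular_plane_curve I \<alpha> a1 a2 a3" "regular_plane_curve J \<omega> w1 w2 w3"
    by (metis regular_curve_onE)
  with base have "curve_pair I \<alpha> a1 a2 a3 J \<omega> w1 w2 w3 t0 s0"
    by (simp add: curve_pair_def curve_pair_axioms_def)
  then show "let \<Phi> = curve_star I J t0 s0 \<alpha> \<omega>
      in parallel_mean_curvature I J \<Phi> \<and> non_null_mean_curvature I J \<Phi>
         \<longleftrightarrow> centered_circle_on I \<alpha> \<and> centered_circle_on J \<omega>"
    unfolding Let_def by (rule curve_pair.parallel_non_null_iff_circles)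
next
  fix R :: real
  assume "R > 0"
  then show "let \<Phi> = curve_star UNIV UNIV 0 0 (\<lambda>t. exp (\<i> * complex_of_real t))
                       (\<lambda>s. complex_of_real R * exp (\<i> * complex_of_real s))
             in (\<forall>t s. \<Phi> t s = (\<i> * complex_of_real (R\<^sup>2 * s - t),
                                complex_of_real R * exp (\<i> * complex_of_real (s + t))))
                \<and> range (\<lambda>(t, s). \<Phi> t s) = range (\<lambda>x. \<i> * complex_of_real x) \<times> sphere 0 R"
    unfolding Let_def curve_star_circles using range_cylinder by blast
qed

end
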